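(* Let $L$ be an abelian extension of a number field $K$ with $L=K(x,y)$ for some $x,y\in L$. Let $\ell=[L:K(x)]$, and let $a,b$ be any nonzero elements of $K$. Then \[L=K\big(ax+b(\ell y-\mathrm{Tr}_{L/K(x)}(y))\big).\] *)

theory Defs
  imports "HOL-Algebra.Algebra"
begin

text \<open>
  A field extension is given by a field \<open>L\<close> (a HOL-Algebra record) together with a subset \<open>K\<close>
  with \<open>subfield K L\<close>; intermediate fields are subsets of \<open>carrier L\<close> too.
\<close>

definition field_adjoin :: "('a, 'b) ring_scheme \<Rightarrow> 'a set \<Rightarrow> 'a set \<Rightarrow> 'a set"
  where "field_adjoin L K S = generate_field L (K \<union> S)"

text \<open>
  The prime field of \<open>F\<close> is \<open>generate_field F {}\<close>; in characteristic zero it is the copy of the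
  rational numbers in \<open>F\<close>.
\<close>

definition number_field :: "('a, 'b) ring_scheme \<Rightarrow> bool"
  where "number_field F \<longleftrightarrow>
    field F \<and>
    (\<forall>n::nat. n > 0 \<longrightarrow> add_pow F n \<one>\<^bsub>F\<^esub> \<noteq> \<zero>\<^bsub>F\<^esub>) \<and>
    ring.finite_dimension F (generate_field F {}) (carrier F)"

text \<open>
  As in \<open>BijGroup\<close>, automorphisms are extensional functions, so that distinct elements of the
  group are distinct maps on \<open>carrier L\<close>.
\<close>

definition galois_automorphisms :: "('a, 'b) ring_scheme \<Rightarrow> 'a set \<Rightarrow> ('a \<Rightarrow> 'a) set"
  where "galois_automorphisms L K =
    {\<sigma> \<in> Bij (carrier L). \<sigma> \<in> ring_hom L L \<and> (\<forall>k\<in>K. \<sigma> k = k)}"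

definition galois_group :: "('a, 'b) ring_scheme \<Rightarrow> 'a set \<Rightarrow> ('a \<Rightarrow> 'a) monoid"
  where "galois_group L K = (BijGroup (carrier L)) \<lparr>carrier := galois_automorphisms L K\<rparr>"

definition galois_extension :: "('a, 'b) ring_scheme \<Rightarrow> 'a set \<Rightarrow> bool"
  where "galois_extension L K \<longleftrightarrow>
    field L \<and> subfield K L \<and>
    (\<forall>z\<in>carrier L. ring.algebraic L K z) \<and>
    {z \<in> carrier L. \<forall>\<sigma>\<in>galois_automorphisms L K. \<sigma> z = z} = K"

definition abelian_extension :: "('a, 'b) ring_scheme \<Rightarrow> 'a set \<Rightarrow> bool"
  where "abelian_extension L K \<longleftrightarrow> galois_extension L K \<and> comm_group (galois_group L K)"

text \<open>
  The trace of the extension \<open>L\<close> of \<open>E\<close> at \<open>z\<close> is the trace of the matrix, with respect to an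
  \<open>E\<close>-basis \<open>Us\<close> of \<open>L\<close>, of the \<open>E\<close>-linear map \<open>w \<mapsto> z w\<close>: column \<open>i\<close> of that matrix consists of
  the coordinates of \<open>z (Us ! i)\<close>. It is only meaningful when \<open>L\<close> has finite dimension over \<open>E\<close>;
  it does not depend on the basis.
\<close>

definition is_basis :: "('a, 'b) ring_scheme \<Rightarrow> 'a set \<Rightarrow> 'a list \<Rightarrow> bool"
  where "is_basis L E Us \<longleftrightarrow> ring.independent L E Us \<and> ring.Span L E Us = carrier L"

definition coordinates :: "('a, 'b) ring_scheme \<Rightarrow> 'a set \<Rightarrow> 'a list \<Rightarrow> 'a \<Rightarrow> 'a list"
  where "coordinates L E Us w =
    (THE Ks. set Ks \<subseteq> E \<and> length Ks = length Us \<and> w = ring.combine L Ks Us)"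

definition field_trace :: "('a, 'b) ring_scheme \<Rightarrow> 'a set \<Rightarrow> 'a \<Rightarrow> 'a"
  where "field_trace L E z =
    (let Us = (SOME Us. is_basis L E Us)
     in \<Oplus>\<^bsub>L\<^esub>i\<in>{..<length Us}. coordinates L E Us (z \<otimes>\<^bsub>L\<^esub> Us ! i) ! i)"

end

theory Submission
  imports Defs
begin

text \<open>
  Let \<open>E = K(x)\<close>, \<open>z = \<ell> y - Tr y\<close> and \<open>\<theta> = a x + b z\<close>. If \<open>\<phi>\<close> in the Galois group of \<open>L / K\<close> fixes \<open>\<theta>\<close>,
  then \<open>a (x - \<phi> x) = b (\<phi> z - z)\<close>. The group is abelian, so \<open>\<phi> x \<in> E\<close> and \<open>\<phi>\<close> commutes with the
  trace to \<open>E\<close>; as \<open>z\<close> has trace zero, taking traces gives \<open>\<ell> a (x - \<phi> x) = 0\<close>. So \<open>\<phi>\<close> fixes \<open>x\<close>,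
  then \<open>z\<close>, then \<open>y\<close>, and is the identity. Hence \<open>L = K(\<theta>)\<close> by the Galois correspondence.

  The Galois theory needed comes from one construction: for an intermediate field \<open>E\<close> there are
  \<open>c\<^sub>j \<in> L\<close> and \<open>e\<^sub>j \<in> E\<close> such that \<open>\<Sum>\<^sub>j \<phi>(c\<^sub>j) e\<^sub>j\<close> is \<open>1\<close> if \<open>\<phi>\<close> fixes \<open>E\<close> and \<open>0\<close> otherwise. Multiplying by
  \<open>\<phi>(w)\<close> and summing over \<open>\<phi>\<close> shows that the fixed field of the group of \<open>L / E\<close> is \<open>E\<close>. For a basis
  in place of the \<open>e\<^sub>j\<close>, the same identity gives a dual basis for the sum of conjugates, which
  identifies that sum with the matrix trace.
\<close>

section \<open>Finite sums and linear combinations\<close>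

lemma (in abelian_monoid) finsum_swap:
  assumes "finite A" "finite B"
    and "\<And>i j. i \<in> A \<Longrightarrow> j \<in> B \<Longrightarrow> g i j \<in> carrier G"
  shows "(\<Oplus>i\<in>A. \<Oplus>j\<in>B. g i j) = (\<Oplus>j\<in>B. \<Oplus>i\<in>A. g i j)"
  using assms(1,3)
proof (induction A rule: finite_induct)
  case (insert i A)
  have "(\<Oplus>j\<in>B. \<Oplus>i\<in>insert i A. g i j) = (\<Oplus>j\<in>B. g i j \<oplus> (\<Oplus>i\<in>A. g i j))"
    using insert by (intro finsum_cong') (auto simp: Pi_def)
  also have "\<dots> = (\<Oplus>j\<in>B. g i j) \<oplus> (\<Oplus>j\<in>B. \<Oplus>i\<in>A. g i j)"
    using insert by (intro finsum_addf) auto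
  finally show ?case
    using insert by (simp add: Pi_def)
qed simp

text \<open>Passes from the recursion on lists to an indexed sum, where terms can be reindexed,
  exchanged and mapped.\<close>

lemma (in ring) combine_eq_finsum:
  assumes "length Ks = length Us" "set Ks \<subseteq> carrier R" "set Us \<subseteq> carrier R"
  shows "combine Ks Us = (\<Oplus>i\<in>{..<length Us}. Ks ! i \<otimes> Us ! i)"
  using assms
proof (induction Ks Us rule: list_induct2)
  case (Cons k Ks u Us)
  then have mem: "Ks ! i \<in> carrier R" "Us ! i \<in> carrier R" if "i < length Us" for i
    using that by (auto simp: subset_iff)
  have range: "{..<length (u # Us)} = insert 0 (Suc ` {..<length Us})"
    by (simp add: lessThan_Suc_eq_insert_0)
  have "(\<Oplus>i\<in>{..<length (u # Us)}. (k # Ks) ! i \<otimes> (u # Us) ! i) =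
      k \<otimes> u \<oplus> (\<Oplus>i\<in>Suc ` {..<length Us}. (k # Ks) ! i \<otimes> (u # Us) ! i)"
    unfolding range using Cons.prems mem by (subst finsum_insert) auto
  also have "(\<Oplus>i\<in>Suc ` {..<length Us}. (k # Ks) ! i \<otimes> (u # Us) ! i) =
      (\<Oplus>i\<in>{..<length Us}. Ks ! i \<otimes> Us ! i)"
    using mem by (subst add.finprod_reindex) auto
  finally show ?case using Cons by simp
qed simp

context field
begin

section \<open>Automorphisms over a subset, and their values on generators\<close>

lemma galois_automorphismsD:
  assumes "\<phi> \<in> galois_automorphisms R E"
  shows "ring_hom_cring R R \<phi>"
    and "\<phi> \<in> Bij (carrier R)"
    and "\<And>e. e \<in> E \<Longrightarrow> \<phi> e = e"
  using assms is_cring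
  by (auto simp: galois_automorphisms_def intro: ring_hom_cring.intro ring_hom_cring_axioms.intro)

lemma galois_automorphisms_closed:
  "\<phi> \<in> galois_automorphisms R E \<Longrightarrow> z \<in> carrier R \<Longrightarrow> \<phi> z \<in> carrier R"
  by (auto simp: galois_automorphisms_def intro: ring_hom_closed)

lemma galois_automorphisms_add:
  "\<phi> \<in> galois_automorphisms R E \<Longrightarrow> z \<in> carrier R \<Longrightarrow> w \<in> carrier R \<Longrightarrow>
    \<phi> (z \<oplus> w) = \<phi> z \<oplus> \<phi> w"
  by (auto simp: galois_automorphisms_def ring_hom_add)

lemma galois_automorphisms_mult:
  "\<phi> \<in> galois_automorphisms R E \<Longrightarrow> z \<in> carrier R \<Longrightarrow> w \<in> carrier R \<Longrightarrow>
    \<phi> (z \<otimes> w) = \<phi> z \<otimes> \<phi> w"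
  by (auto simp: galois_automorphisms_def ring_hom_mult)

lemma galois_automorphisms_inj:
  "\<phi> \<in> galois_automorphisms R E \<Longrightarrow> inj_on \<phi> (carrier R)"
  by (auto simp: galois_automorphisms_def Bij_def bij_betw_def)

lemma galois_automorphisms_surj:
  assumes "\<phi> \<in> galois_automorphisms R E" "z \<in> carrier R"
  obtains w where "w \<in> carrier R" "\<phi> w = z"
proof -
  have "\<phi> ` carrier R = carrier R"
    using assms(1) by (simp add: galois_automorphisms_def Bij_def bij_betw_def)
  then show thesis using assms(2) that by (metis imageE)
qed

lemma galois_automorphisms_eqI:
  assumes "\<phi> \<in> galois_automorphisms R E" "\<tau> \<in> galois_automorphisms R F"
    and "\<And>z. z \<in> carrier R \<Longrightarrow> \<phi> z = \<tau> z"
  shows "\<phi> = \<tau>"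
  using assms by (auto simp: galois_automorphisms_def Bij_def intro: extensionalityI)

lemma galois_automorphisms_antimono:
  "E \<subseteq> F \<Longrightarrow> galois_automorphisms R F \<subseteq> galois_automorphisms R E"
  by (auto simp: galois_automorphisms_def)

lemma id_galois_automorphism:
  "E \<subseteq> carrier R \<Longrightarrow> (\<lambda>z\<in>carrier R. z) \<in> galois_automorphisms R E"
  by (auto simp: galois_automorphisms_def id_Bij intro: ring_hom_memI)

lemma compose_galois_automorphism:
  assumes "E \<subseteq> carrier R"
    and \<phi>: "\<phi> \<in> galois_automorphisms R E" and \<tau>: "\<tau> \<in> galois_automorphisms R E"
  shows "compose (carrier R) \<phi> \<tau> \<in> galois_automorphisms R E"
proof -
  interpret \<phi>: ring_hom_cring R R \<phi> by (rule galois_automorphismsD[OF \<phi>])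
  interpret \<tau>: ring_hom_cring R R \<tau> by (rule galois_automorphismsD[OF \<tau>])
  show ?thesis
    using assms galois_automorphismsD[OF \<phi>] galois_automorphismsD[OF \<tau>]
    by (auto simp: galois_automorphisms_def compose_Bij compose_eq intro!: ring_hom_memI)
qed

text \<open>A generated field is the least subfield containing its generators, so this reduces
  agreement of two maps to agreement on generators. Taking the identity for \<open>\<tau>\<close>
  does the same for being fixed.\<close>

lemma equalizer_subfield:
  assumes "ring_hom_cring R R \<phi>" and "ring_hom_cring R R \<tau>"
  shows "subfield {z \<in> carrier R. \<phi> z = \<tau> z} R"
proof -
  interpret \<phi>: ring_hom_cring R R \<phi> by fact
  interpret \<tau>: ring_hom_cring R R \<tau> by fact
  let ?A = "{z \<in> carrier R. \<phi> z = \<tau> z}"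
  show ?thesis
  proof (rule subfieldI')
    show "subring ?A R"
      by (rule subringI) auto
    fix k assume k: "k \<in> ?A - {\<zero>}"
    then have u: "k \<in> Units R" and kc: "k \<in> carrier R" by (auto simp: field_Units)
    have ic: "inv k \<in> carrier R" using u by simp
    \<comment> \<open>Both images of \<open>inv k\<close> are inverses of the one element
      \<open>\<phi> k = \<tau> k\<close>, hence they coincide.\<close>
    have 1: "\<phi> (inv k) \<otimes> \<phi> k = \<one>"
      using u kc ic by (simp flip: \<phi>.hom_mult)
    have 2: "\<phi> k \<otimes> \<tau> (inv k) = \<one>"
      using k u kc ic by (simp flip: \<tau>.hom_mult)
    have "\<phi> (inv k) = \<tau> (inv k)"
      by (rule inv_unique[OF 1 2]) (use kc ic in auto)
    then show "inv k \<in> ?A" using ic by simp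
  qed
qed

lemma galois_automorphisms_eq_on_generators:
  assumes "carrier R = generate_field R (E \<union> S)" "E \<subseteq> carrier R" "S \<subseteq> carrier R"
    and \<phi>: "\<phi> \<in> galois_automorphisms R E" and \<tau>: "\<tau> \<in> galois_automorphisms R E"
    and "\<And>s. s \<in> S \<Longrightarrow> \<phi> s = \<tau> s"
  shows "\<phi> = \<tau>"
proof (rule galois_automorphisms_eqI[OF \<phi> \<tau>])
  have "generate_field R (E \<union> S) \<subseteq> {z \<in> carrier R. \<phi> z = \<tau> z}"
    using assms galois_automorphismsD[OF \<phi>] galois_automorphismsD[OF \<tau>]
    by (intro generate_field_min_subfield1 equalizer_subfield) auto
  then show "\<And>z. z \<in> carrier R \<Longrightarrow> \<phi> z = \<tau> z" using assms(1) by auto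
qed

lemma galois_automorphism_of_adjoin:
  assumes "E \<subseteq> carrier R" "S \<subseteq> carrier R" and \<phi>: "\<phi> \<in> galois_automorphisms R E"
    and "\<And>s. s \<in> S \<Longrightarrow> \<phi> s = s"
  shows "\<phi> \<in> galois_automorphisms R (generate_field R (E \<union> S))"
proof -
  have "ring_hom_cring R R (\<lambda>z. z)"
    by unfold_locales (auto intro: ring_hom_memI)
  then have "generate_field R (E \<union> S) \<subseteq> {z \<in> carrier R. \<phi> z = z}"
    using assms galois_automorphismsD[OF \<phi>]
    by (intro generate_field_min_subfield1 equalizer_subfield) auto
  then show ?thesis using \<phi> by (auto simp: galois_automorphisms_def)
qed

text \<open>An automorphism is determined by its values on \<open>S\<close>, and it sends each
  \<open>s\<close> to a root of a nonzero polynomial over \<open>E\<close> that annihilates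
  \<open>s\<close>. So the group injects into a finite product of finite root sets.\<close>

lemma finite_galois_automorphisms:
  assumes E: "subfield E R" and "finite S" "S \<subseteq> carrier R"
    and gen: "carrier R = generate_field R (E \<union> S)"
    and alg: "\<And>s. s \<in> S \<Longrightarrow> (algebraic over E) s"
  shows "finite (galois_automorphisms R E)"
proof -
  note Er = subfieldE(1)[OF E]
  have "\<exists>p. p \<in> carrier (E[X]) \<and> p \<noteq> [] \<and> eval p s = \<zero>" if "s \<in> S" for s
  proof -
    have "s \<in> carrier R" using that assms(3) by auto
    from algebraicE[OF Er this alg[OF that]] show ?thesis by metis
  qed
  then obtain p where p: "\<And>s. s \<in> S \<Longrightarrow> p s \<in> carrier (E[X]) \<and> p s \<noteq> [] \<and> eval (p s) s = \<zero>"
    by metis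
  define A where "A s = {z. is_root (p s) z}" for s
  have fin: "finite (A s)" if "s \<in> S" for s
    using finite_number_of_roots[of "p s"] p[OF that] carrier_polynomial_shell[OF Er]
    by (auto simp: A_def)
  have root: "\<phi> s \<in> A s" if \<phi>: "\<phi> \<in> galois_automorphisms R E" and s: "s \<in> S" for \<phi> s
  proof -
    interpret \<phi>: ring_hom_cring R R \<phi> by (rule galois_automorphismsD[OF \<phi>])
    have hom: "ring_hom_ring R R \<phi>"
      by (intro ring_hom_ringI2 ring_axioms \<phi>.homh)
    have sc: "s \<in> carrier R" using s assms(3) by auto
    have "set (p s) \<subseteq> E"
      using p[OF s] by (simp add: polynomial_incl flip: univ_poly_carrier)
    then have "map \<phi> (p s) = p s"
      by (intro map_idI galois_automorphismsD[OF \<phi>]) auto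
    moreover have "\<phi> (eval (p s) s) = eval (map \<phi> (p s)) (\<phi> s)"
      using ring_hom_ring.eval_hom[OF hom Er sc] p[OF s] by blast
    ultimately have "eval (p s) (\<phi> s) = \<zero>"
      using p[OF s] \<phi>.hom_zero by metis
    then show ?thesis using p[OF s] sc by (simp add: A_def is_root_def)
  qed
  have "inj_on (\<lambda>\<phi>. restrict \<phi> S) (galois_automorphisms R E)"
  proof (rule inj_onI)
    fix \<phi> \<tau> assume *: "\<phi> \<in> galois_automorphisms R E" "\<tau> \<in> galois_automorphisms R E"
      "restrict \<phi> S = restrict \<tau> S"
    show "\<phi> = \<tau>"
      by (rule galois_automorphisms_eq_on_generators[OF gen subfieldE(3)[OF E] assms(3) *(1,2)])
         (metis *(3) restrict_apply')
  qed
  moreover have "(\<lambda>\<phi>. restrict \<phi> S) ` galois_automorphisms R E \<subseteq> PiE S A"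
    using root by auto
  ultimately show ?thesis
    using finite_PiE[OF assms(2) fin] by (meson finite_imageD finite_subset)
qed

section \<open>Sums of conjugates, the Galois form of the trace\<close>

definition galois_trace :: "'a set \<Rightarrow> 'a \<Rightarrow> 'a"
  where "galois_trace E z = (\<Oplus>\<phi>\<in>galois_automorphisms R E. \<phi> z)"

lemma galois_trace_closed:
  "z \<in> carrier R \<Longrightarrow> galois_trace E z \<in> carrier R"
  unfolding galois_trace_def by (intro finsum_closed) (auto intro: galois_automorphisms_closed)

lemma galois_trace_add:
  assumes "z \<in> carrier R" "w \<in> carrier R"
  shows "galois_trace E (z \<oplus> w) = galois_trace E z \<oplus> galois_trace E w"
proof -
  have "galois_trace E (z \<oplus> w) = (\<Oplus>\<phi>\<in>galois_automorphisms R E. \<phi> z \<oplus> \<phi> w)"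
    unfolding galois_trace_def using assms
    by (intro finsum_cong')
       (auto simp: galois_automorphisms_closed galois_automorphisms_add)
  then show ?thesis
    using assms by (simp add: galois_trace_def finsum_addf galois_automorphisms_closed)
qed

lemma galois_trace_smult:
  assumes fin: "finite (galois_automorphisms R E)" and "k \<in> E" "E \<subseteq> carrier R" "z \<in> carrier R"
  shows "galois_trace E (k \<otimes> z) = k \<otimes> galois_trace E z"
proof -
  have "galois_trace E (k \<otimes> z) = (\<Oplus>\<phi>\<in>galois_automorphisms R E. k \<otimes> \<phi> z)"
    unfolding galois_trace_def using assms
    by (intro finsum_cong')
       (auto simp: galois_automorphisms_closed galois_automorphismsD(3) galois_automorphisms_mult subset_iff)
  then show ?thesis
    using assms by (simp add: galois_trace_def finsum_rdistr galois_automorphisms_closed subset_iff)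
qed

lemma galois_trace_base:
  assumes "k \<in> E" "E \<subseteq> carrier R"
  shows "galois_trace E k = [card (galois_automorphisms R E)] \<cdot> k"
proof -
  have "galois_trace E k = (\<Oplus>\<phi>\<in>galois_automorphisms R E. k)"
    unfolding galois_trace_def using assms
    by (intro finsum_cong') (auto simp: galois_automorphismsD)
  then show ?thesis using assms by (auto simp: add.finprod_const)
qed

text \<open>Composition with \<open>\<phi>\<close> is an injective map of a finite group to itself,
  hence a permutation, and only reorders the conjugates.\<close>

lemma galois_trace_fixed:
  assumes fin: "finite (galois_automorphisms R E)" and E: "E \<subseteq> carrier R"
    and \<phi>: "\<phi> \<in> galois_automorphisms R E" and z: "z \<in> carrier R"
  shows "\<phi> (galois_trace E z) = galois_trace E z"
proof -
  let ?G = "galois_automorphisms R E"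
  interpret \<phi>: ring_hom_cring R R \<phi> by (rule galois_automorphismsD[OF \<phi>])
  have inj: "inj_on (compose (carrier R) \<phi>) ?G"
  proof (rule inj_onI)
    fix \<tau> \<rho> assume *: "\<tau> \<in> ?G" "\<rho> \<in> ?G" "compose (carrier R) \<phi> \<tau> = compose (carrier R) \<phi> \<rho>"
    show "\<tau> = \<rho>"
    proof (rule galois_automorphisms_eqI[OF *(1,2)])
      fix w assume w: "w \<in> carrier R"
      then have "\<phi> (\<tau> w) = \<phi> (\<rho> w)" using *(3) by (metis compose_eq)
      then show "\<tau> w = \<rho> w"
        using galois_automorphisms_inj[OF \<phi>] * w galois_automorphisms_closed
        by (auto dest: inj_onD)
    qed
  qed
  have img: "compose (carrier R) \<phi> ` ?G = ?G"
    by (rule endo_inj_surj[OF fin _ inj]) (auto intro: compose_galois_automorphism[OF E \<phi>])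
  have "galois_trace E z = (\<Oplus>\<tau>\<in>compose (carrier R) \<phi> ` ?G. \<tau> z)"
    by (simp add: galois_trace_def img)
  also have "\<dots> = (\<Oplus>\<tau>\<in>?G. compose (carrier R) \<phi> \<tau> z)"
    by (rule add.finprod_reindex[OF _ inj])
       (auto simp: img galois_automorphisms_closed z)
  also have "\<dots> = (\<Oplus>\<tau>\<in>?G. \<phi> (\<tau> z))"
    by (intro finsum_cong') (auto simp: z compose_eq galois_automorphisms_closed)
  also have "\<dots> = \<phi> (galois_trace E z)"
    by (simp add: galois_trace_def o_def galois_automorphisms_closed z)
  finally show ?thesis ..
qed

lemma galois_trace_finsum:
  assumes "finite I" "\<And>i. i \<in> I \<Longrightarrow> g i \<in> carrier R"
  shows "galois_trace E (\<Oplus>i\<in>I. g i) = (\<Oplus>i\<in>I. galois_trace E (g i))"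
  using assms
proof (induction I rule: finite_induct)
  case empty
  have "galois_trace E \<zero> = (\<Oplus>\<phi>\<in>galois_automorphisms R E. \<zero>)"
    unfolding galois_trace_def
    by (intro finsum_cong') (auto simp: ring_hom_zero galois_automorphisms_def ring_axioms)
  then show ?case by simp
next
  case (insert i I)
  then show ?case by (simp add: Pi_def galois_trace_add galois_trace_closed)
qed

section \<open>Tensors that separate automorphisms, and fixed fields\<close>

text \<open>The elements of \<open>L \<otimes> E\<close>, seen through the maps \<open>c \<otimes> e \<mapsto> \<phi>(c) e\<close>.\<close>

inductive_set tensor_maps :: "'a set \<Rightarrow> (('a \<Rightarrow> 'a) \<Rightarrow> 'a) set"
  for E where
    pure: "c \<in> carrier R \<Longrightarrow> e \<in> E \<Longrightarrow> (\<lambda>\<phi>. \<phi> c \<otimes> e) \<in> tensor_maps E"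
  | add: "f \<in> tensor_maps E \<Longrightarrow> g \<in> tensor_maps E \<Longrightarrow> (\<lambda>\<phi>. f \<phi> \<oplus> g \<phi>) \<in> tensor_maps E"

lemma tensor_maps_closed:
  assumes "f \<in> tensor_maps E" "E \<subseteq> carrier R" "\<phi> \<in> galois_automorphisms R K"
  shows "f \<phi> \<in> carrier R"
  using assms by induction (auto simp: galois_automorphisms_closed subset_iff)

text \<open>Multiplication in the tensor product. The product is matched only on automorphisms,
  since elsewhere \<open>\<phi>\<close> need not be multiplicative.\<close>

lemma tensor_maps_mult_pure:
  assumes "f \<in> tensor_maps E" and E: "subring E R" and c: "c \<in> carrier R" and e: "e \<in> E"
  shows "\<exists>g\<in>tensor_maps E. \<forall>\<phi>\<in>galois_automorphisms R K. g \<phi> = f \<phi> \<otimes> (\<phi> c \<otimes> e)"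
  using assms(1)
proof induction
  case (pure c' e')
  have "e' \<in> carrier R" "e \<in> carrier R" using subringE(1)[OF E] pure e by auto
  then show ?case
    using pure c e tensor_maps.pure[of "c' \<otimes> c" "e' \<otimes> e" E] subringE(6)[OF E]
    by (intro bexI[of _ "\<lambda>\<phi>. \<phi> (c' \<otimes> c) \<otimes> (e' \<otimes> e)"])
       (auto simp: galois_automorphisms_mult galois_automorphisms_closed m_ac)
next
  case (add f g)
  then obtain f' g' where *: "f' \<in> tensor_maps E" "g' \<in> tensor_maps E"
    "\<And>\<phi>. \<phi> \<in> galois_automorphisms R K \<Longrightarrow> f' \<phi> = f \<phi> \<otimes> (\<phi> c \<otimes> e)"
    "\<And>\<phi>. \<phi> \<in> galois_automorphisms R K \<Longrightarrow> g' \<phi> = g \<phi> \<otimes> (\<phi> c \<otimes> e)"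
    by auto
  have "e \<in> carrier R" using subringE(1)[OF E] e by auto
  then show ?case
    using * c tensor_maps_closed[OF add(1) subringE(1)[OF E]]
      tensor_maps_closed[OF add(2) subringE(1)[OF E]]
    by (intro bexI[OF _ tensor_maps.add[OF *(1,2)]])
       (auto simp: l_distr galois_automorphisms_closed)
qed

text \<open>With \<open>S\<close> the whole difference of the two groups, \<open>f\<close> is the
  indicator of the automorphisms fixing \<open>E\<close>. It is built as a product with one factor
  for each \<open>\<psi>\<close> in \<open>S\<close>, obtained from an element of \<open>E\<close>
  that \<open>\<psi>\<close> moves.\<close>

lemma tensor_maps_separate:
  assumes E: "subring E R" and "finite S"
    and "S \<subseteq> galois_automorphisms R K - galois_automorphisms R E" and "K \<subseteq> E"
  shows "\<exists>f\<in>tensor_maps E. (\<forall>\<phi>\<in>galois_automorphisms R E. f \<phi> = \<one>) \<and> (\<forall>\<phi>\<in>S. f \<phi> = \<zero>)"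
  using assms(2,3)
proof (induction S rule: finite_induct)
  case empty
  show ?case
    using tensor_maps.pure[OF one_closed subringE(3)[OF E]]
    by (intro bexI[of _ "\<lambda>\<phi>. \<phi> \<one> \<otimes> \<one>"])
       (auto simp: galois_automorphisms_def ring_hom_one)
next
  case (insert \<psi> S)
  let ?G = "galois_automorphisms R K"
  from insert obtain f where f: "f \<in> tensor_maps E"
    "\<And>\<phi>. \<phi> \<in> galois_automorphisms R E \<Longrightarrow> f \<phi> = \<one>" "\<And>\<phi>. \<phi> \<in> S \<Longrightarrow> f \<phi> = \<zero>" by auto
  note EC = subringE(1)[OF E]
  have \<psi>: "\<psi> \<in> ?G" "\<psi> \<notin> galois_automorphisms R E" using insert by auto
  then obtain e where e: "e \<in> E" "\<psi> e \<noteq> e" by (auto simp: galois_automorphisms_def)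
  then have ec: "e \<in> carrier R" using EC by auto
  obtain c where c: "c \<in> carrier R" "\<psi> c = e"
    by (rule galois_automorphisms_surj[OF \<psi>(1) ec])
  \<comment> \<open>Multiply \<open>f\<close> by the tensor \<open>(c \<otimes> 1 - 1 \<otimes> e) (d \<otimes> 1)\<close>, which is \<open>0\<close> at \<open>\<psi>\<close> and \<open>1\<close> on automorphisms fixing \<open>e\<close>.\<close>
  define d where "d = inv (c \<ominus> e)"
  \<comment> \<open>If \<open>c = e\<close>, then \<open>\<psi> c = e\<close> would say that
    \<open>\<psi>\<close> fixes \<open>e\<close>.\<close>
  have "c \<ominus> e \<in> Units R"
    using c ec e by (auto simp: field_Units)
  then have d: "d \<in> carrier R" "d \<otimes> (c \<ominus> e) = \<one>"
    by (auto simp: d_def)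
  \<comment> \<open>The multiplier is a sum of two pure tensors, \<open>d c\<close> tensor
    \<open>1\<close> and \<open>d\<close> tensor \<open>-e\<close>; \<open>g1\<close> and
    \<open>g2\<close> are the products of \<open>f\<close> with each.\<close>
  obtain g1 where g1: "g1 \<in> tensor_maps E"
    "\<And>\<phi>. \<phi> \<in> ?G \<Longrightarrow> g1 \<phi> = f \<phi> \<otimes> (\<phi> (d \<otimes> c) \<otimes> \<one>)"
    using tensor_maps_mult_pure[OF f(1) E _ subringE(3)[OF E], of "d \<otimes> c" K] c d by auto
  obtain g2 where g2: "g2 \<in> tensor_maps E"
    "\<And>\<phi>. \<phi> \<in> ?G \<Longrightarrow> g2 \<phi> = f \<phi> \<otimes> (\<phi> d \<otimes> \<ominus> e)"
    using tensor_maps_mult_pure[OF f(1) E d(1) subringE(5)[OF E e(1)], of K] by auto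
  define g where "g \<phi> = g1 \<phi> \<oplus> g2 \<phi>" for \<phi>
  have gT: "g \<in> tensor_maps E"
    unfolding g_def by (rule tensor_maps.add[OF g1(1) g2(1)])
  have g: "g \<phi> = f \<phi> \<otimes> (\<phi> d \<otimes> (\<phi> c \<ominus> e))" if "\<phi> \<in> ?G" for \<phi>
    using that c d ec tensor_maps_closed[OF f(1) EC that]
    by (simp add: g_def g1 g2 galois_automorphisms_mult galois_automorphisms_closed
        minus_eq r_distr)
  show ?case
  proof (intro bexI[OF _ gT] conjI ballI)
    fix \<phi> assume \<phi>: "\<phi> \<in> galois_automorphisms R E"
    then have \<phi>G: "\<phi> \<in> ?G" using galois_automorphisms_antimono[OF assms(4)] by auto
    interpret \<phi>: ring_hom_cring R R \<phi> by (rule galois_automorphismsD[OF \<phi>])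
    have "\<phi> d \<otimes> (\<phi> c \<ominus> \<phi> e) = \<phi> (d \<otimes> (c \<ominus> e))"
      using c d(1) ec by (simp add: minus_eq)
    then show "g \<phi> = \<one>"
      using g[OF \<phi>G] d f(2)[OF \<phi>] galois_automorphismsD(3)[OF \<phi> e(1)] by simp
  next
    fix \<phi> assume "\<phi> \<in> insert \<psi> S"
    moreover from this have \<phi>: "\<phi> \<in> ?G" using insert by auto
    ultimately show "g \<phi> = \<zero>"
      using f(3) c d(1) ec g[OF \<phi>] tensor_maps_closed[OF f(1) EC \<phi>]
        galois_automorphisms_closed[OF \<psi>(1) d(1)]
      by (auto simp: galois_automorphisms_closed[OF \<phi>] r_neg minus_eq)
  qed
qed

text \<open>For a pure tensor the sum is \<open>galois_trace K (c \<otimes> z) \<otimes> e\<close>.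
  Its first factor is invariant under the group over \<open>K\<close>, so it lies in
  \<open>K\<close>, and the product lies in \<open>E\<close>. Additivity does the rest.\<close>

lemma tensor_maps_trace_in:
  assumes E: "subring E R" and "K \<subseteq> E" and fin: "finite (galois_automorphisms R K)"
    and fixed: "{z \<in> carrier R. \<forall>\<phi>\<in>galois_automorphisms R K. \<phi> z = z} \<subseteq> K"
    and "f \<in> tensor_maps E" and z: "z \<in> carrier R"
  shows "(\<Oplus>\<phi>\<in>galois_automorphisms R K. f \<phi> \<otimes> \<phi> z) \<in> E"
  using assms(5)
proof induction
  case (pure c e)
  have KC: "K \<subseteq> carrier R" using subringE(1)[OF E] assms(2) by auto
  have ec: "e \<in> carrier R" using subringE(1)[OF E] pure by auto
  have "galois_trace K (c \<otimes> z) \<in> K"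
    using fixed galois_trace_fixed[OF fin KC] galois_trace_closed pure z by auto
  moreover have "(\<Oplus>\<phi>\<in>galois_automorphisms R K. \<phi> c \<otimes> e \<otimes> \<phi> z) = galois_trace K (c \<otimes> z) \<otimes> e"
    unfolding galois_trace_def using fin ec z pure
    by (subst finsum_ldistr)
       (auto intro!: finsum_cong' simp: galois_automorphisms_closed galois_automorphisms_mult m_ac)
  ultimately show ?case using assms(2) pure subringE(6)[OF E] by auto
next
  case (add f g)
  note cl = tensor_maps_closed[OF _ subringE(1)[OF E]]
  have "(\<Oplus>\<phi>\<in>galois_automorphisms R K. (f \<phi> \<oplus> g \<phi>) \<otimes> \<phi> z) =
    (\<Oplus>\<phi>\<in>galois_automorphisms R K. (f \<phi> \<otimes> \<phi> z) \<oplus> (g \<phi> \<otimes> \<phi> z))"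
    using add z
    by (intro finsum_cong') (auto simp: l_distr galois_automorphisms_closed cl)
  also have "\<dots> = (\<Oplus>\<phi>\<in>galois_automorphisms R K. f \<phi> \<otimes> \<phi> z) \<oplus>
    (\<Oplus>\<phi>\<in>galois_automorphisms R K. g \<phi> \<otimes> \<phi> z)"
    using add z by (intro finsum_addf) (auto simp: galois_automorphisms_closed cl)
  finally show ?case using add subringE(7)[OF E] by simp
qed

text \<open>Only the automorphisms fixing \<open>E\<close> contribute, each with the term
  \<open>z\<close>. This evaluates the sum that \<open>tensor_maps_trace_in\<close> places in
  \<open>E\<close>.\<close>

lemma tensor_maps_indicator_sum:
  assumes "K \<subseteq> E" "E \<subseteq> carrier R" and fin: "finite (galois_automorphisms R K)"
    and f: "f \<in> tensor_maps E" "\<And>\<phi>. \<phi> \<in> galois_automorphisms R E \<Longrightarrow> f \<phi> = \<one>"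
      "\<And>\<phi>. \<phi> \<in> galois_automorphisms R K - galois_automorphisms R E \<Longrightarrow> f \<phi> = \<zero>"
    and z: "z \<in> carrier R" "\<And>\<phi>. \<phi> \<in> galois_automorphisms R E \<Longrightarrow> \<phi> z = z"
  shows "(\<Oplus>\<phi>\<in>galois_automorphisms R K. f \<phi> \<otimes> \<phi> z) = [card (galois_automorphisms R E)] \<cdot> z"
proof -
  have "(\<Oplus>\<phi>\<in>galois_automorphisms R K. f \<phi> \<otimes> \<phi> z) = (\<Oplus>\<phi>\<in>galois_automorphisms R E. z)"
    using fin galois_automorphisms_antimono[OF assms(1)] z
    by (intro add.finprod_mono_neutral_cong_right)
       (auto simp: f galois_automorphisms_closed tensor_maps_closed[OF f(1) assms(2)])
  then show ?thesis using z by (simp add: add.finprod_const)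
qed

text \<open>Let \<open>n\<close> be the order of the group over \<open>E\<close>. Summing the
  indicator against conjugates puts \<open>n z\<close> into \<open>E\<close> for every invariant
  \<open>z\<close>, and likewise \<open>n 1\<close>. In characteristic zero one can divide by
  \<open>n 1\<close> inside \<open>E\<close>.\<close>

theorem galois_fixed_field:
  assumes E: "subfield E R" and "K \<subseteq> E" and fin: "finite (galois_automorphisms R K)"
    and fixed: "{z \<in> carrier R. \<forall>\<phi>\<in>galois_automorphisms R K. \<phi> z = z} \<subseteq> K"
    and char: "\<And>n::nat. n > 0 \<Longrightarrow> [n] \<cdot> \<one> \<noteq> \<zero>"
  shows "{z \<in> carrier R. \<forall>\<phi>\<in>galois_automorphisms R E. \<phi> z = z} = E"
proof (intro equalityI subsetI)
  fix z assume "z \<in> {z \<in> carrier R. \<forall>\<phi>\<in>galois_automorphisms R E. \<phi> z = z}"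
  then have z: "z \<in> carrier R" "\<And>\<phi>. \<phi> \<in> galois_automorphisms R E \<Longrightarrow> \<phi> z = z" by auto
  note Er = subfieldE(1)[OF E]
  let ?n = "card (galois_automorphisms R E)"
  obtain f where f: "f \<in> tensor_maps E" "\<And>\<phi>. \<phi> \<in> galois_automorphisms R E \<Longrightarrow> f \<phi> = \<one>"
      "\<And>\<phi>. \<phi> \<in> galois_automorphisms R K - galois_automorphisms R E \<Longrightarrow> f \<phi> = \<zero>"
    using tensor_maps_separate[OF Er finite_Diff[OF fin] order_refl assms(2)] by metis
  have mem: "[?n] \<cdot> w \<in> E"
    if w: "w \<in> carrier R" "\<And>\<phi>. \<phi> \<in> galois_automorphisms R E \<Longrightarrow> \<phi> w = w" for w
  proof -
    have "(\<Oplus>\<phi>\<in>galois_automorphisms R K. f \<phi> \<otimes> \<phi> w) = [?n] \<cdot> w"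
      by (rule tensor_maps_indicator_sum[OF assms(2) subringE(1)[OF Er] fin f(1)]) (use f w in auto)
    then show ?thesis
      using tensor_maps_trace_in[OF Er assms(2) fin fixed f(1) w(1)] by simp
  qed
  have nz: "[?n] \<cdot> z \<in> E"
    by (rule mem) (use z in auto)
  have n1: "[?n] \<cdot> \<one> \<in> E"
    by (rule mem) (use galois_automorphismsD(3) subringE(3)[OF Er] in auto)
  have "finite (galois_automorphisms R E)"
    using fin galois_automorphisms_antimono[OF assms(2)] by (rule finite_subset[rotated])
  then have "?n > 0"
    using id_galois_automorphism[OF subringE(1)[OF Er]] by (auto simp: card_gt_0_iff)
  moreover have "[?n] \<cdot> \<one> \<otimes> z = [?n] \<cdot> z"
    using z by (simp add: add_pow_ldistr)
  ultimately show "z \<in> E"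
    using subfield_m_inv_simprule[OF E, of "[?n] \<cdot> \<one>" z] n1 nz z char by auto
qed (use subfieldE(3)[OF E] galois_automorphismsD(3) in auto)

section \<open>Bases, and the matrix trace as a sum of conjugates\<close>

context
  fixes E Us
  assumes E: "subfield E R" and basis: "is_basis R E Us"
begin

lemma basis_in_carrier: "set Us \<subseteq> carrier R"
  using basis independent_in_carrier by (auto simp: is_basis_def)

lemma basis_nth_closed: "i < length Us \<Longrightarrow> Us ! i \<in> carrier R"
  using basis_in_carrier by auto

lemma basis_expansion:
  assumes "w \<in> carrier R"
  obtains k where "\<And>i. i < length Us \<Longrightarrow> k i \<in> E" "w = (\<Oplus>i\<in>{..<length Us}. k i \<otimes> Us ! i)"
proof -
  obtain Ks where Ks: "set Ks \<subseteq> E" "length Ks = length Us" "w = combine Ks Us"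
    using assms basis Span_mem_iff_length_version[OF E basis_in_carrier] by (auto simp: is_basis_def)
  moreover have "set Ks \<subseteq> carrier R" using Ks subfieldE(3)[OF E] by auto
  ultimately show thesis
    using that[of "(!) Ks"] combine_eq_finsum[OF _ _ basis_in_carrier] nth_mem by fastforce
qed

text \<open>\<open>coordinates\<close> is a definite description; independence of the basis makes
  the expansion unique, so any expansion found determines its value.\<close>

lemma coordinates_eq:
  assumes k: "\<And>i. i < length Us \<Longrightarrow> k i \<in> E" and w: "w = (\<Oplus>i\<in>{..<length Us}. k i \<otimes> Us ! i)"
    and "i < length Us"
  shows "coordinates R E Us w ! i = k i"
proof -
  let ?Ks = "map k [0..<length Us]"
  have kc: "k i \<in> carrier R" if "i < length Us" for i
    using k[OF that] subfieldE(3)[OF E] by auto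
  have "w \<in> carrier R"
    unfolding w by (intro finsum_closed) (auto simp: kc basis_nth_closed)
  then have ex1: "\<exists>!Ks. set Ks \<subseteq> E \<and> length Ks = length Us \<and> w = combine Ks Us"
    using unique_decomposition[OF E, of Us w] basis by (auto simp: is_basis_def)
  have "set ?Ks \<subseteq> carrier R" using kc by auto
  then have "combine ?Ks Us = (\<Oplus>i\<in>{..<length Us}. ?Ks ! i \<otimes> Us ! i)"
    by (intro combine_eq_finsum basis_in_carrier) auto
  also have "\<dots> = w"
    unfolding w by (intro finsum_cong') (auto simp: kc basis_nth_closed)
  finally have "coordinates R E Us w = ?Ks"
    unfolding coordinates_def using k by (intro the1_equality[OF ex1]) auto
  then show ?thesis using assms(3) by simp
qed

text \<open>Expand the second tensor factor in the basis and move its coefficients to the first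
  factor: they lie in \<open>E\<close>, so \<open>\<phi>\<close> fixes them.\<close>

lemma tensor_maps_carrier_expansion:
  assumes "f \<in> tensor_maps (carrier R)"
  shows "\<exists>c. (\<forall>i<length Us. c i \<in> carrier R) \<and>
    (\<forall>\<phi>\<in>galois_automorphisms R E. f \<phi> = (\<Oplus>i\<in>{..<length Us}. \<phi> (c i) \<otimes> Us ! i))"
  using assms
proof induction
  case (pure c e)
  obtain k where k: "\<And>i. i < length Us \<Longrightarrow> k i \<in> E" "e = (\<Oplus>i\<in>{..<length Us}. k i \<otimes> Us ! i)"
    using basis_expansion[OF pure(2)] by blast
  have kc: "k i \<in> carrier R" if "i < length Us" for i
    using k(1)[OF that] subfieldE(3)[OF E] by auto
  have "\<phi> c \<otimes> e = (\<Oplus>i\<in>{..<length Us}. \<phi> (c \<otimes> k i) \<otimes> Us ! i)"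
    if \<phi>: "\<phi> \<in> galois_automorphisms R E" for \<phi>
  proof -
    have "\<phi> c \<otimes> e = (\<Oplus>i\<in>{..<length Us}. \<phi> c \<otimes> (k i \<otimes> Us ! i))"
      unfolding k(2) using pure kc
      by (intro finsum_rdistr) (auto simp: basis_nth_closed galois_automorphisms_closed[OF \<phi>])
    also have "\<dots> = (\<Oplus>i\<in>{..<length Us}. \<phi> (c \<otimes> k i) \<otimes> Us ! i)"
      using pure kc
      by (intro finsum_cong') (auto simp: basis_nth_closed galois_automorphisms_closed[OF \<phi>]
          galois_automorphisms_mult[OF \<phi>] galois_automorphismsD(3)[OF \<phi>] k(1) m_assoc)
    finally show ?thesis .
  qed
  then show ?case using pure kc by (intro exI[of _ "\<lambda>i. c \<otimes> k i"]) auto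
next
  case (add f g)
  then obtain c d where c: "\<And>i. i < length Us \<Longrightarrow> c i \<in> carrier R"
      "\<And>\<phi>. \<phi> \<in> galois_automorphisms R E \<Longrightarrow> f \<phi> = (\<Oplus>i\<in>{..<length Us}. \<phi> (c i) \<otimes> Us ! i)"
    and d: "\<And>i. i < length Us \<Longrightarrow> d i \<in> carrier R"
      "\<And>\<phi>. \<phi> \<in> galois_automorphisms R E \<Longrightarrow> g \<phi> = (\<Oplus>i\<in>{..<length Us}. \<phi> (d i) \<otimes> Us ! i)"
    by blast
  have "f \<phi> \<oplus> g \<phi> = (\<Oplus>i\<in>{..<length Us}. \<phi> (c i \<oplus> d i) \<otimes> Us ! i)"
    if \<phi>: "\<phi> \<in> galois_automorphisms R E" for \<phi>
  proof -
    have "f \<phi> \<oplus> g \<phi> = (\<Oplus>i\<in>{..<length Us}. (\<phi> (c i) \<otimes> Us ! i) \<oplus> (\<phi> (d i) \<otimes> Us ! i))"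
      unfolding c(2)[OF \<phi>] d(2)[OF \<phi>]
      by (intro finsum_addf[symmetric])
         (auto simp: basis_nth_closed galois_automorphisms_closed[OF \<phi>] c d)
    also have "\<dots> = (\<Oplus>i\<in>{..<length Us}. \<phi> (c i \<oplus> d i) \<otimes> Us ! i)"
      by (intro finsum_cong') (auto simp: basis_nth_closed galois_automorphisms_closed[OF \<phi>]
          galois_automorphisms_add[OF \<phi>] c d l_distr)
    finally show ?thesis .
  qed
  then show ?case using c d by (intro exI[of _ "\<lambda>i. c i \<oplus> d i"]) auto
qed

text \<open>Expanding the indicator of the identity yields elements \<open>c i\<close> dual to the
  basis for the sum of conjugates. The diagonal entries of the matrix are then the traces of
  \<open>c i \<otimes> (z \<otimes> Us ! i)\<close>, and they add up to the trace of
  \<open>z\<close> because the products \<open>c i \<otimes> Us ! i\<close> sum to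
  \<open>\<one>\<close>.\<close>

lemma coordinates_trace_eq_galois_trace:
  assumes fin: "finite (galois_automorphisms R E)"
    and fixed: "{z \<in> carrier R. \<forall>\<phi>\<in>galois_automorphisms R E. \<phi> z = z} \<subseteq> E"
    and z: "z \<in> carrier R"
  shows "(\<Oplus>i\<in>{..<length Us}. coordinates R E Us (z \<otimes> Us ! i) ! i) = galois_trace E z"
proof -
  let ?H = "galois_automorphisms R E"
  let ?n = "length Us"
  let ?id = "\<lambda>z\<in>carrier R. z"
  have EC: "E \<subseteq> carrier R" by (rule subfieldE(3)[OF E])
  \<comment> \<open>With \<open>carrier R\<close> as the larger field, the separating tensor becomes
    the indicator of the identity alone.\<close>
  have only_id: "galois_automorphisms R (carrier R) = {?id}"
  proof -
    have id: "?id \<in> galois_automorphisms R (carrier R)" by (rule id_galois_automorphism) simp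
    have "\<phi> = ?id" if "\<phi> \<in> galois_automorphisms R (carrier R)" for \<phi>
      by (rule galois_automorphisms_eqI[OF that id]) (simp add: galois_automorphismsD(3)[OF that])
    then show ?thesis using id by blast
  qed
  have "\<exists>f\<in>tensor_maps (carrier R). (\<forall>\<phi>\<in>galois_automorphisms R (carrier R). f \<phi> = \<one>) \<and>
      (\<forall>\<phi>\<in>?H - galois_automorphisms R (carrier R). f \<phi> = \<zero>)"
    by (rule tensor_maps_separate[OF carrier_is_subring finite_Diff[OF fin] order_refl EC])
  then obtain f where f: "f \<in> tensor_maps (carrier R)"
      "\<And>\<phi>. \<phi> \<in> galois_automorphisms R (carrier R) \<Longrightarrow> f \<phi> = \<one>"
      "\<And>\<phi>. \<phi> \<in> ?H - galois_automorphisms R (carrier R) \<Longrightarrow> f \<phi> = \<zero>"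
    by blast
  obtain c where c: "\<And>i. i < ?n \<Longrightarrow> c i \<in> carrier R"
      "\<And>\<phi>. \<phi> \<in> ?H \<Longrightarrow> f \<phi> = (\<Oplus>i\<in>{..<?n}. \<phi> (c i) \<otimes> Us ! i)"
    using tensor_maps_carrier_expansion[OF f(1)] by blast
  have tr_in: "galois_trace E w \<in> E" if "w \<in> carrier R" for w
  proof -
    have "\<phi> (galois_trace E w) = galois_trace E w" if "\<phi> \<in> ?H" for \<phi>
      using galois_trace_fixed[OF fin EC that] \<open>w \<in> carrier R\<close> .
    then show ?thesis using fixed galois_trace_closed[OF that] by blast
  qed
  \<comment> \<open>Duality: write \<open>w\<close> as the indicator summed against its conjugates,
    insert the expansion of \<open>f\<close>, and exchange the two sums.\<close>
  have expand: "w = (\<Oplus>i\<in>{..<?n}. galois_trace E (c i \<otimes> w) \<otimes> Us ! i)" if w: "w \<in> carrier R" for w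
  proof -
    have "w = (\<Oplus>\<phi>\<in>?H. f \<phi> \<otimes> \<phi> w)"
      using w by (subst tensor_maps_indicator_sum[OF EC order_refl fin f(1)])
        (auto simp: f only_id galois_automorphismsD(3))
    also have "\<dots> = (\<Oplus>\<phi>\<in>?H. \<Oplus>i\<in>{..<?n}. \<phi> (c i \<otimes> w) \<otimes> Us ! i)"
    proof (intro finsum_cong')
      fix \<phi> assume \<phi>: "\<phi> \<in> ?H"
      have "f \<phi> \<otimes> \<phi> w = (\<Oplus>i\<in>{..<?n}. \<phi> (c i) \<otimes> Us ! i \<otimes> \<phi> w)"
        unfolding c(2)[OF \<phi>] using w
        by (intro finsum_ldistr) (auto simp: basis_nth_closed galois_automorphisms_closed[OF \<phi>] c)
      also have "\<dots> = (\<Oplus>i\<in>{..<?n}. \<phi> (c i \<otimes> w) \<otimes> Us ! i)"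
        using w by (intro finsum_cong') (auto simp: basis_nth_closed galois_automorphisms_closed[OF \<phi>] c
            galois_automorphisms_mult[OF \<phi>] m_ac)
      finally show "f \<phi> \<otimes> \<phi> w = (\<Oplus>i\<in>{..<?n}. \<phi> (c i \<otimes> w) \<otimes> Us ! i)" .
    qed (auto intro!: finsum_closed simp: basis_nth_closed galois_automorphisms_closed c w)
    also have "\<dots> = (\<Oplus>i\<in>{..<?n}. \<Oplus>\<phi>\<in>?H. \<phi> (c i \<otimes> w) \<otimes> Us ! i)"
      using fin w by (intro finsum_swap) (auto simp: basis_nth_closed galois_automorphisms_closed c)
    also have "\<dots> = (\<Oplus>i\<in>{..<?n}. galois_trace E (c i \<otimes> w) \<otimes> Us ! i)"
      unfolding galois_trace_def using fin w
      by (intro finsum_cong' finsum_ldistr[symmetric])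
         (auto intro!: finsum_closed simp: basis_nth_closed galois_automorphisms_closed c)
    finally show ?thesis .
  qed
  \<comment> \<open>This is the value of the indicator at the identity.\<close>
  have one: "(\<Oplus>i\<in>{..<?n}. c i \<otimes> Us ! i) = \<one>"
  proof -
    have "(\<Oplus>i\<in>{..<?n}. c i \<otimes> Us ! i) = (\<Oplus>i\<in>{..<?n}. ?id (c i) \<otimes> Us ! i)"
      by (intro finsum_cong') (auto simp: c basis_nth_closed)
    also have "\<dots> = f ?id" using c(2)[OF id_galois_automorphism[OF EC]] by simp
    finally show ?thesis using f(2) only_id by simp
  qed
  have "(\<Oplus>i\<in>{..<?n}. coordinates R E Us (z \<otimes> Us ! i) ! i) =
      (\<Oplus>i\<in>{..<?n}. galois_trace E (c i \<otimes> (z \<otimes> Us ! i)))"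
  proof (intro finsum_cong')
    fix i assume i: "i \<in> {..<?n}"
    then have zu: "z \<otimes> Us ! i \<in> carrier R" using z basis_nth_closed by simp
    show "coordinates R E Us (z \<otimes> Us ! i) ! i = galois_trace E (c i \<otimes> (z \<otimes> Us ! i))"
      using i zu c tr_in
      by (intro coordinates_eq[where k = "\<lambda>j. galois_trace E (c j \<otimes> (z \<otimes> Us ! i))"] expand[OF zu]) auto
  qed (auto intro!: galois_trace_closed simp: basis_nth_closed z c)
  also have "\<dots> = galois_trace E (\<Oplus>i\<in>{..<?n}. c i \<otimes> (z \<otimes> Us ! i))"
    by (intro galois_trace_finsum[symmetric]) (auto simp: basis_nth_closed z c)
  also have "(\<Oplus>i\<in>{..<?n}. c i \<otimes> (z \<otimes> Us ! i)) = (\<Oplus>i\<in>{..<?n}. z \<otimes> (c i \<otimes> Us ! i))"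
    by (intro finsum_cong') (auto simp: basis_nth_closed z c m_ac)
  also have "\<dots> = z \<otimes> (\<Oplus>i\<in>{..<?n}. c i \<otimes> Us ! i)"
    by (intro finsum_rdistr[symmetric]) (auto simp: basis_nth_closed z c)
  also have "\<dots> = z" using one z by simp
  finally show ?thesis .
qed

end

text \<open>The identity holds for every basis, hence for the one that \<open>SOME\<close> selects;
  \<open>Us\<close> witnesses that there is one.\<close>

theorem field_trace_eq_galois_trace:
  assumes "subfield E R" "is_basis R E Us" "finite (galois_automorphisms R E)"
    and "{z \<in> carrier R. \<forall>\<phi>\<in>galois_automorphisms R E. \<phi> z = z} \<subseteq> E"
    and "z \<in> carrier R"
  shows "field_trace R E z = galois_trace E z"
  unfolding field_trace_def Let_def
  by (rule coordinates_trace_eq_galois_trace) (use assms someI[of "is_basis R E" Us] in auto)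

text \<open>Both sides are the trace of \<open>\<one>\<close>: once from the identity matrix, once
  as a sum of conjugates. The equality is between elements of the field, which is how the degree
  enters later.\<close>

lemma length_basis_eq_card_galois:
  assumes E: "subfield E R" and basis: "is_basis R E Us"
    and fin: "finite (galois_automorphisms R E)"
    and "{z \<in> carrier R. \<forall>\<phi>\<in>galois_automorphisms R E. \<phi> z = z} \<subseteq> E"
  shows "[length Us] \<cdot> \<one> = [card (galois_automorphisms R E)] \<cdot> \<one>"
proof -
  have one: "\<one> \<in> E" using subringE(3)[OF subfieldE(1)[OF E]] .
  have zero: "\<zero> \<in> E" using subringE(2)[OF subfieldE(1)[OF E]] .
  have "(\<Oplus>i\<in>{..<length Us}. coordinates R E Us (\<one> \<otimes> Us ! i) ! i) = (\<Oplus>i\<in>{..<length Us}. \<one>)"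
  proof (intro finsum_cong')
    fix i assume "i \<in> {..<length Us}"
    then have ui: "Us ! i \<in> carrier R" by (simp add: basis_nth_closed[OF E basis])
    have "(\<Oplus>j\<in>{..<length Us}. (if i = j then \<one> else \<zero>) \<otimes> Us ! j) =
        (\<Oplus>j\<in>{..<length Us}. if i = j then Us ! j else \<zero>)"
      by (intro finsum_cong') (auto simp: basis_nth_closed[OF E basis])
    also have "\<dots> = Us ! i"
      using \<open>i \<in> {..<length Us}\<close> by (intro finsum_singleton) (auto simp: basis_nth_closed[OF E basis])
    finally show "coordinates R E Us (\<one> \<otimes> Us ! i) ! i = \<one>"
      using one zero ui \<open>i \<in> {..<length Us}\<close>
      by (subst coordinates_eq[OF E basis, where k = "\<lambda>j. if i = j then \<one> else \<zero>"]) auto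
  qed auto
  also have "\<dots> = [length Us] \<cdot> \<one>" by (simp add: add.finprod_const)
  finally show ?thesis
    using coordinates_trace_eq_galois_trace[OF assms one_closed]
      galois_trace_base[OF one subfieldE(3)[OF E]] by simp
qed

text \<open>Adjoining algebraic elements to \<open>E\<close> as a ring already gives a field of
  finite dimension over \<open>E\<close>. It contains \<open>K\<close> and the generators, so it is
  everything.\<close>

lemma exists_basis_of_finitely_generated:
  assumes K: "subfield K R" and E: "subfield E R" and "K \<subseteq> E" and xs: "set xs \<subseteq> carrier R"
    and gen: "carrier R = generate_field R (K \<union> set xs)"
    and alg: "\<And>z. z \<in> set xs \<Longrightarrow> (algebraic over K) z"
  shows "\<exists>Us. is_basis R E Us"
proof -
  let ?M = "finite_extension E xs"
  have algE: "(algebraic over E) z" if "z \<in> set xs" for z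
    by (rule algebraic_mono[OF assms(3) alg[OF that]])
  have "subfield ?M R" by (rule finite_extension_is_subfield[OF E xs algE])
  moreover have "K \<union> set xs \<subseteq> ?M"
    using finite_extension_incl[OF subfieldE(3)[OF E] xs] assms(3)
      finite_extension_mem[OF subfieldE(1)[OF E] xs] by blast
  ultimately have "carrier R \<subseteq> ?M"
    unfolding gen using subfieldE(3)[OF K] xs by (intro generate_field_min_subfield1) auto
  then have "?M = carrier R"
    using finite_extension_in_carrier[OF subfieldE(3)[OF E] xs] by blast
  then have "finite_dimension E (carrier R)"
    using finite_extension_finite_dimension(1)[OF E xs algE] by simp
  then show ?thesis
    using exists_base[OF E] unfolding finite_dimension_def is_basis_def by blast
qed

section \<open>Consequences of commutativity\<close>

lemma galois_automorphisms_commute: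
  assumes "comm_group (galois_group R K)"
    and "\<phi> \<in> galois_automorphisms R K" "\<tau> \<in> galois_automorphisms R K" "z \<in> carrier R"
  shows "\<phi> (\<tau> z) = \<tau> (\<phi> z)"
proof -
  interpret G: comm_group "galois_group R K" by fact
  have "compose (carrier R) \<phi> \<tau> = compose (carrier R) \<tau> \<phi>"
    using G.m_comm[of \<phi> \<tau>] assms(2,3) galois_automorphismsD(2)
    by (auto simp: galois_group_def BijGroup_def)
  then show ?thesis using assms(4) by (metis compose_eq)
qed

text \<open>Since \<open>K \<subseteq> E\<close>, each \<open>\<tau>\<close> in the sum belongs to
  the abelian group over \<open>K\<close> and commutes with \<open>\<phi>\<close>.\<close>

lemma galois_trace_commute:
  assumes "K \<subseteq> E" and ab: "comm_group (galois_group R K)"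
    and \<phi>: "\<phi> \<in> galois_automorphisms R K" and z: "z \<in> carrier R"
  shows "\<phi> (galois_trace E z) = galois_trace E (\<phi> z)"
proof -
  interpret \<phi>: ring_hom_cring R R \<phi> by (rule galois_automorphismsD[OF \<phi>])
  have "\<phi> (galois_trace E z) = (\<Oplus>\<tau>\<in>galois_automorphisms R E. \<phi> (\<tau> z))"
    by (simp add: galois_trace_def o_def galois_automorphisms_closed z)
  also have "\<dots> = galois_trace E (\<phi> z)"
    unfolding galois_trace_def
    using galois_automorphisms_commute[OF ab \<phi>] galois_automorphisms_antimono[OF assms(1)] z
    by (intro finsum_cong') (auto simp: galois_automorphisms_closed)
  finally show ?thesis .
qed

end

section \<open>The generator of the abelian extension\<close>

theorem theorem8p2:
  fixes L :: "('a, 'b) ring_scheme" (structure)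
    and K :: "'a set" and x y a b :: 'a and l :: nat
  assumes "field L" and "subfield K L"
    and "number_field (L\<lparr>carrier := K\<rparr>)"
    and "abelian_extension L K"
    and "x \<in> carrier L" and "y \<in> carrier L"
    and "carrier L = field_adjoin L K {x, y}"
    and "l = ring.dim L (field_adjoin L K {x}) (carrier L)"
    and "a \<in> K" and "a \<noteq> \<zero>" and "b \<in> K" and "b \<noteq> \<zero>"
  shows "carrier L =
    field_adjoin L K
      {a \<otimes> x \<oplus> b \<otimes> ([l] \<cdot> y \<ominus> field_trace L (field_adjoin L K {x}) y)}"
proof -
  interpret field L by fact
  define E where "E = field_adjoin L K {x}"
  define t where "t = galois_trace E y"
  define z where "z = [l] \<cdot> y \<ominus> t"
  define \<theta> where "\<theta> = a \<otimes> x \<oplus> b \<otimes> z"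
  define F where "F = field_adjoin L K {\<theta>}"
  note x = assms(5) and y = assms(6)
  have K: "subfield K L" by fact
  have KC: "K \<subseteq> carrier L" by (rule subfieldE(3)[OF K])
  have gal: "galois_extension L K" and ab: "comm_group (galois_group L K)"
    using assms(4) by (auto simp: abelian_extension_def)
  have alg: "(algebraic over K) w" if "w \<in> carrier L" for w
    using gal that by (auto simp: galois_extension_def over_def)
  have fixK: "{w \<in> carrier L. \<forall>\<phi>\<in>galois_automorphisms L K. \<phi> w = w} \<subseteq> K"
    using gal by (auto simp: galois_extension_def)
  \<comment> \<open>Replacing the carrier by \<open>K\<close> changes neither the operations nor the
    constants, so multiples of \<open>\<one>\<close> are the same in \<open>K\<close> and
    \<open>L\<close>.\<close>
  have char: "[n] \<cdot> \<one> \<noteq> \<zero>" if "n > 0" for n :: nat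
    using assms(3) that by (auto simp: number_field_def add_pow_def nat_pow_def)
  have gen: "carrier L = generate_field L (K \<union> {x, y})"
    using assms(7) by (simp add: field_adjoin_def)
  have finK: "finite (galois_automorphisms L K)"
    using x y by (intro finite_galois_automorphisms[OF K _ _ gen] alg) auto

  have E: "subfield E L" and KE: "K \<subseteq> E" and xE: "x \<in> E"
    using generate_fieldE[of "K \<union> {x}" E] KC x by (auto simp: E_def field_adjoin_def)
  have Er: "subring E L" and EC: "E \<subseteq> carrier L" using subfieldE(1,3)[OF E] .
  have finE: "finite (galois_automorphisms L E)"
    using finK galois_automorphisms_antimono[OF KE] by (rule finite_subset[rotated])
  have fixE: "{w \<in> carrier L. \<forall>\<phi>\<in>galois_automorphisms L E. \<phi> w = w} = E"
    by (rule galois_fixed_field[OF E KE finK fixK char])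
  obtain Us where Us: "is_basis L E Us"
    using exists_basis_of_finitely_generated[OF K E KE, of "[x, y]"] x y gen alg by auto
  have "dimension (length Us) E (carrier L)"
    using Us dimension_independent[of E Us] by (auto simp: is_basis_def)
  then have l: "l = length Us"
    using assms(8) dimI[OF E] by (auto simp: E_def over_def)
  have card: "[l] \<cdot> \<one> = [card (galois_automorphisms L E)] \<cdot> \<one>"
    unfolding l using fixE by (intro length_basis_eq_card_galois[OF E Us finE]) auto
  have l0: "[l] \<cdot> \<one> \<noteq> \<zero>"
    unfolding card using finE id_galois_automorphism[OF EC] by (intro char) (auto simp: card_gt_0_iff)
  have l_mult: "[l] \<cdot> w = [l] \<cdot> \<one> \<otimes> w" if "w \<in> carrier L" for w
    using that by (simp add: add_pow_ldistr)
  have lE: "[l] \<cdot> \<one> \<in> E"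
  proof -
    have "[n] \<cdot> \<one> \<in> E" for n :: nat
      using subringE(2,3,7)[OF Er] by (induction n) (auto simp: add.nat_pow_Suc)
    then show ?thesis .
  qed
  have l_cancel: "u = v" if "[l] \<cdot> u = [l] \<cdot> v" "u \<in> carrier L" "v \<in> carrier L" for u v
    using that l0 l_mult[of u] l_mult[of v] by (simp add: m_lcancel)
  have trace_E: "galois_trace E e = [l] \<cdot> e" if "e \<in> E" for e
  proof -
    have "e \<in> carrier L" using that EC by auto
    then have "[card (galois_automorphisms L E)] \<cdot> e = [l] \<cdot> e"
      using l_mult[of e] add_pow_ldistr[of \<one> e "card (galois_automorphisms L E)"] card by simp
    then show ?thesis using galois_trace_base[OF that EC] by simp
  qed
  have trace_in: "galois_trace E w \<in> E" if "w \<in> carrier L" for w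
    using fixE galois_trace_fixed[OF finE EC _ that] galois_trace_closed[OF that] by blast

  have tE: "t \<in> E" and tc: "t \<in> carrier L"
    using trace_in[OF y] EC by (auto simp: t_def)
  have zc: "z \<in> carrier L" using y tc by (simp add: z_def)
  have aE: "a \<in> E" and bE: "b \<in> E" using assms(9,11) KE by auto
  have ac: "a \<in> carrier L" and bc: "b \<in> carrier L" using aE bE EC by auto
  have \<theta>c: "\<theta> \<in> carrier L" using x ac bc zc by (simp add: \<theta>_def)
  \<comment> \<open>The element \<open>z \<oplus> t\<close> is \<open>l\<close> times
    \<open>y\<close>, with trace \<open>l\<close> times \<open>t\<close>; as \<open>t\<close> lies
    in \<open>E\<close>, its own trace is also \<open>l\<close> times \<open>t\<close>.\<close>
  have tz: "galois_trace E z = \<zero>"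
  proof -
    have "galois_trace E (z \<oplus> t) = galois_trace E z \<oplus> galois_trace E t"
      by (rule galois_trace_add[OF zc tc])
    moreover have "z \<oplus> t = [l] \<cdot> \<one> \<otimes> y"
      using y tc l_mult[OF y] by (simp add: z_def minus_eq a_assoc l_neg)
    moreover have "galois_trace E ([l] \<cdot> \<one> \<otimes> y) = [l] \<cdot> t"
      using galois_trace_smult[OF finE lE EC y] l_mult[OF tc] by (simp add: t_def)
    ultimately have "[l] \<cdot> t = galois_trace E z \<oplus> [l] \<cdot> t"
      using trace_E[OF tE] by simp
    then show ?thesis
      using galois_trace_closed[OF zc] tc by (metis add.nat_pow_closed add.r_cancel_one)
  qed

  have F: "subfield F L" and KF: "K \<subseteq> F" and \<theta>F: "\<theta> \<in> F"
    using generate_fieldE[of "K \<union> {\<theta>}" F] KC \<theta>c by (auto simp: F_def field_adjoin_def)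
  \<comment> \<open>Since \<open>F\<close> is the fixed field of its group, it is enough that this
    group acts trivially.\<close>
  have trivial: "\<phi> w = w" if \<phi>F: "\<phi> \<in> galois_automorphisms L F" and w: "w \<in> carrier L" for \<phi> w
  proof -
    have \<phi>: "\<phi> \<in> galois_automorphisms L K"
      using \<phi>F galois_automorphisms_antimono[OF KF] by auto
    interpret \<phi>: ring_hom_cring L L \<phi> by (rule galois_automorphismsD[OF \<phi>])
    \<comment> \<open>Commutativity makes \<open>E\<close> stable: an automorphism
      \<open>\<tau>\<close> over \<open>E\<close> fixes \<open>x\<close>, so it fixes
      \<open>\<phi> x\<close> too.\<close>
    have \<phi>x: "\<phi> x \<in> E"
    proof -
      have "\<tau> (\<phi> x) = \<phi> x" if \<tau>: "\<tau> \<in> galois_automorphisms L E" for \<tau>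
      proof -
        have "\<tau> \<in> galois_automorphisms L K" using \<tau> galois_automorphisms_antimono[OF KE] by auto
        from galois_automorphisms_commute[OF ab this \<phi> x] show ?thesis
          using galois_automorphismsD(3)[OF \<tau> xE] by simp
      qed
      then show ?thesis using fixE x \<phi>.hom_closed by blast
    qed
    have \<phi>\<theta>: "\<phi> \<theta> = a \<otimes> \<phi> x \<oplus> b \<otimes> \<phi> z"
      using x zc ac bc galois_automorphismsD(3)[OF \<phi>] assms(9,11) by (simp add: \<theta>_def)
    have fix\<theta>: "a \<otimes> \<phi> x \<oplus> b \<otimes> \<phi> z = a \<otimes> x \<oplus> b \<otimes> z"
      using galois_automorphismsD(3)[OF \<phi>F \<theta>F] \<phi>\<theta> by (simp add: \<theta>_def)
    have trace: "galois_trace E (a \<otimes> u \<oplus> b \<otimes> v) = [l] \<cdot> (a \<otimes> u)"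
      if u: "u \<in> E" and v: "v \<in> carrier L" "galois_trace E v = \<zero>" for u v
    proof -
      have "u \<in> carrier L" using u EC by auto
      then show ?thesis
        using v ac bc galois_trace_smult[OF finE bE EC v(1)] trace_E[OF subringE(6)[OF Er aE u]]
        by (simp add: galois_trace_add)
    qed
    have "galois_trace E (\<phi> z) = \<zero>"
      using galois_trace_commute[OF KE ab \<phi> zc] tz by simp
    \<comment> \<open>Take traces to \<open>E\<close> on both sides of \<open>fix\<theta>\<close>;
      the terms with \<open>z\<close> and \<open>\<phi> z\<close> vanish.\<close>
    then have "[l] \<cdot> (a \<otimes> \<phi> x) = [l] \<cdot> (a \<otimes> x)"
      using trace[OF \<phi>x, of "\<phi> z"] trace[OF xE zc tz] fix\<theta> zc by simp
    then have "a \<otimes> \<phi> x = a \<otimes> x"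
      by (rule l_cancel) (use ac x in auto)
    then have xfix: "\<phi> x = x"
      using m_lcancel[OF assms(10) ac] x by simp
    \<comment> \<open>Fixing \<open>x\<close> means fixing all of \<open>E\<close>, in particular
      \<open>t\<close>, so that \<open>\<phi> z = z\<close> becomes a statement about
      \<open>y\<close> alone.\<close>
    have \<phi>E: "\<phi> \<in> galois_automorphisms L E"
      unfolding E_def field_adjoin_def
      by (rule galois_automorphism_of_adjoin[OF KC _ \<phi>]) (use x xfix in auto)
    have "b \<otimes> \<phi> z = b \<otimes> z"
      using fix\<theta> xfix x ac bc zc by (metis add.l_cancel m_closed \<phi>.hom_closed)
    then have "\<phi> z = z"
      using m_lcancel[OF assms(12) bc] zc by simp
    moreover have "\<phi> z = [l] \<cdot> \<phi> y \<ominus> t"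
    proof -
      have "\<phi> ([l] \<cdot> \<one> \<otimes> y) = [l] \<cdot> \<one> \<otimes> \<phi> y"
        using galois_automorphismsD(3)[OF \<phi>E lE] y by simp
      then have "\<phi> ([l] \<cdot> y) = [l] \<cdot> \<phi> y"
        using l_mult[OF y] l_mult[OF \<phi>.hom_closed[OF y]] by simp
      then show ?thesis
        using y tc galois_automorphismsD(3)[OF \<phi>E tE] by (simp add: z_def minus_eq)
    qed
    ultimately have "[l] \<cdot> \<phi> y \<oplus> \<ominus> t = [l] \<cdot> y \<oplus> \<ominus> t"
      by (simp add: z_def minus_eq)
    then have "[l] \<cdot> \<phi> y = [l] \<cdot> y"
      using y tc by (metis add.r_cancel add.nat_pow_closed a_inv_closed \<phi>.hom_closed)
    then have yfix: "\<phi> y = y"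
      by (rule l_cancel) (use y in auto)
    have "\<phi> \<in> galois_automorphisms L (generate_field L (K \<union> {x, y}))"
      by (rule galois_automorphism_of_adjoin[OF KC _ \<phi>]) (use x y xfix yfix in auto)
    then show ?thesis
      using galois_automorphismsD(3) w gen by simp
  qed
  have "F = {w \<in> carrier L. \<forall>\<phi>\<in>galois_automorphisms L F. \<phi> w = w}"
    by (rule galois_fixed_field[OF F KF finK fixK char, symmetric])
  then have "carrier L = F" using trivial by blast
  moreover have "field_trace L E y = t"
    unfolding t_def using fixE by (intro field_trace_eq_galois_trace[OF E Us finE _ y]) auto
  ultimately show ?thesis
    by (simp add: F_def \<theta>_def z_def flip: E_def)
qed

end
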